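(* Let $\mathcal{S}$ be a balanced system of $\mathbb{Z}$-equations in $r$ variables, and assume there is a subsystem $\mathcal{S}'$ of $\mathcal{S}$ that is dominant and irreducible (as a system in the original $r$ variables); let $b_{\mathcal{S}'}$ be its dominant coefficient. Then for every prime $p>b_{\mathcal{S}'}$ and every $\epsilon>0$ there exists $n_0=n_0(p,\epsilon)$ such that for all $n\geq n_0$, \[ \mathrm{ex}_{\mathcal{S}}(n,p)\geq \left((1-\epsilon)\left\lfloor \frac{p+b_{\mathcal{S}'}-1}{b_{\mathcal{S}'}}\right\rfloor\right)^n . \] In particular, if moreover $b_{\mathcal{S}'}\geq 2$, then for $n$ sufficiently large depending on $p$, $\mathrm{ex}_{\mathcal{S}}(n,p)\geq (p/b_{\mathcal{S}'})^n$.
   Context: A $\mathbb{Z}$-equation is $\sum_{i=1}^r b_ix_i=0$ with $b_i\in\mathbb{Z}$; it is balanced if $\sum_i b_i=0$, and a system is balanced if all its equations are. A balanced $\mathbb{Z}$-equation is dominant if there is $j\in[r]$ with $b_j>0$ and $b_i\leq 0$ for all $i\neq j$, or with $b_j<0$ and $b_i\geq0$ for all $i\neq j$; then $|b_j|$ is its dominant coefficient. A system is dominant if all its equations are dominant, and its dominant coefficient is the maximum of the dominant coefficients of its equations. A subsystem is a nonempty subcollection of the equations. For a system in variables $x_1,\dots,x_r$ with equations indexed by $l$, let $e_l$ be the set of indices with nonzero coefficient in equation $l$; the system is irreducible if $\bigcup_l e_l=[r]$ and the hypergraph with edges $e_l$ is connected. For a prime $p$, $\mathcal{S}(p)$ is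 the system of $\mathbb{F}_p$-equations obtained by reducing coefficients mod $p$. For a balanced system $\mathcal{T}$ of $\mathbb{F}_p$-equations, $A\subseteq\mathbb{F}_p^n$ is strongly $\mathcal{T}$-free if every solution $(x_1,\dots,x_r)\in A^r$ of $\mathcal{T}$ has $x_1=\cdots=x_r$; $\mathrm{ex}_{\mathcal{S}}(n,p)$ is the maximum size of a strongly $\mathcal{S}(p)$-free subset of $\mathbb{F}_p^n$.
   Formalization: The bound is stated for 0 < ε ≤ 1 instead of every ε > 0, because for large ε the base (1−ε)⌊(p+b−1)/b⌋ is negative and its even powers exceed p^n (e.g. ε = p+2), so the literal claim fails. *)

theory Defs
  imports Complex_Main "HOL-Number_Theory.Residues"
begin

text \<open>
  The variables are indexed by a finite type \<open>'r\<close> in place of \<open>{1, ..., r}\<close>. A linear equation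
  \<open>\<Sum>i. b i * x i = 0\<close> is given by its coefficient function \<open>b\<close>, and a system is a set of such
  functions. Being finite is part of the notion of a system; it is an explicit
  hypothesis wherever it matters.
\<close>

type_synonym ('r, 'a) equation = "'r \<Rightarrow> 'a"
type_synonym ('r, 'a) eqsystem = "('r, 'a) equation set"

definition subsystem :: "('r, 'a) eqsystem \<Rightarrow> ('r, 'a) eqsystem \<Rightarrow> bool" where
  "subsystem S' S \<longleftrightarrow> S' \<subseteq> S \<and> S' \<noteq> {}"

definition balanced_eq :: "('r::finite, int) equation \<Rightarrow> bool" where
  "balanced_eq b \<longleftrightarrow> (\<Sum>i\<in>UNIV. b i) = 0"

definition balanced :: "('r::finite, int) eqsystem \<Rightarrow> bool" where
  "balanced S \<longleftrightarrow> (\<forall>b\<in>S. balanced_eq b)"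

definition dominant_at :: "('r::finite, int) equation \<Rightarrow> 'r \<Rightarrow> bool" where
  "dominant_at b j \<longleftrightarrow>
     (b j > 0 \<and> (\<forall>i. i \<noteq> j \<longrightarrow> b i \<le> 0)) \<or> (b j < 0 \<and> (\<forall>i. i \<noteq> j \<longrightarrow> b i \<ge> 0))"

definition dominant_eq :: "('r::finite, int) equation \<Rightarrow> bool" where
  "dominant_eq b \<longleftrightarrow> balanced_eq b \<and> (\<exists>j. dominant_at b j)"

text \<open>
  The index \<open>j\<close> need not be unique (consider \<open>x - y = 0\<close>), but \<open>\<bar>b j\<bar>\<close> is; see
  \<open>dominant_coeff_eq_abs\<close> below.
\<close>

definition dominant_coeff_eq :: "('r::finite, int) equation \<Rightarrow> int" where
  "dominant_coeff_eq b = (THE c. \<exists>j. dominant_at b j \<and> c = \<bar>b j\<bar>)"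

definition dominant :: "('r::finite, int) eqsystem \<Rightarrow> bool" where
  "dominant S \<longleftrightarrow> (\<forall>b\<in>S. dominant_eq b)"

definition dominant_coeff :: "('r::finite, int) eqsystem \<Rightarrow> int" where
  "dominant_coeff S = Max (dominant_coeff_eq ` S)"

lemma dominant_at_abs_unique:
  assumes "balanced_eq b" "dominant_at b j" "dominant_at b k"
  shows "\<bar>b j\<bar> = \<bar>b k\<bar>"
proof (cases "j = k")
  case False
  have zero: "b i = 0" if "i \<in> UNIV - {j, k}" for i
    using assms(2,3) that False unfolding dominant_at_def
    by (metis Diff_iff insertCI order.antisym order.asym order.strict_iff_not)
  have "0 = (\<Sum>i\<in>UNIV. b i)"
    using assms(1) by (simp add: balanced_eq_def)
  also have "\<dots> = (\<Sum>i\<in>{j, k}. b i)"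
    by (rule sum.mono_neutral_right) (use zero in auto)
  also have "\<dots> = b j + b k"
    using False by simp
  finally show ?thesis by linarith
qed simp

lemma dominant_coeff_eq_abs:
  assumes "balanced_eq b" "dominant_at b j"
  shows "dominant_coeff_eq b = \<bar>b j\<bar>"
  unfolding dominant_coeff_eq_def
  using assms dominant_at_abs_unique[OF assms(1)] by (intro the_equality) blast+

definition eq_support :: "('r, int) equation \<Rightarrow> 'r set" where
  "eq_support b = {i. b i \<noteq> 0}"

text \<open>
  A hypergraph on the vertex set \<open>V\<close> is connected if any two vertices are joined by a
  walk whose consecutive vertices lie in a common edge.
\<close>

definition hypergraph_connected :: "'v set \<Rightarrow> 'v set set \<Rightarrow> bool" where
  "hypergraph_connected V E \<longleftrightarrow>
     (\<forall>u\<in>V. \<forall>v\<in>V. (u, v) \<in> {(x, y). \<exists>e\<in>E. x \<in> e \<and> y \<in> e}\<^sup>*)"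

definition irreducible_system :: "('r::finite, int) eqsystem \<Rightarrow> bool" where
  "irreducible_system S \<longleftrightarrow>
     (\<Union>b\<in>S. eq_support b) = UNIV \<and> hypergraph_connected UNIV (eq_support ` S)"

text \<open>
  The field with \<open>p\<close> elements is \<open>residue_ring (int p)\<close>, with carrier \<open>{0..int p - 1}\<close>;
  its \<open>n\<close>-th power consists of the functions from \<open>{..<n}\<close> to this carrier, made
  extensional so that equality of functions is equality of vectors.
\<close>

definition reduce_system :: "nat \<Rightarrow> ('r, int) eqsystem \<Rightarrow> ('r, int) eqsystem" where
  "reduce_system p S = (\<lambda>b i. b i mod int p) ` S"

definition Fp_space :: "nat \<Rightarrow> nat \<Rightarrow> (nat \<Rightarrow> int) set" where
  "Fp_space p n = {..<n} \<rightarrow>\<^sub>E carrier (residue_ring (int p))"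

definition Fp_solution ::
    "nat \<Rightarrow> nat \<Rightarrow> ('r::finite, int) eqsystem \<Rightarrow> ('r \<Rightarrow> nat \<Rightarrow> int) \<Rightarrow> bool" where
  "Fp_solution p n T x \<longleftrightarrow>
     (\<forall>b\<in>T. \<forall>k<n.
        (\<Oplus>\<^bsub>residue_ring (int p)\<^esub> i\<in>UNIV. b i \<otimes>\<^bsub>residue_ring (int p)\<^esub> x i k)
          = \<zero>\<^bsub>residue_ring (int p)\<^esub>)"

definition strongly_free ::
    "nat \<Rightarrow> nat \<Rightarrow> ('r::finite, int) eqsystem \<Rightarrow> (nat \<Rightarrow> int) set \<Rightarrow> bool" where
  "strongly_free p n T A \<longleftrightarrow> A \<subseteq> Fp_space p n \<and>
     (\<forall>x. (\<forall>i. x i \<in> A) \<and> Fp_solution p n T x \<longrightarrow> (\<forall>i j. x i = x j))"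

definition ex_system :: "('r::finite, int) eqsystem \<Rightarrow> nat \<Rightarrow> nat \<Rightarrow> nat" where
  "ex_system S n p = Max {card A |A. strongly_free p n (reduce_system p S) A}"

end

theory Submission
  imports Defs
begin

text \<open>
  Behrend's construction. Put \<open>M = \<lceil>p / b\<rceil>\<close> with \<open>b\<close> the dominant coefficient, so that
  \<open>b * (M - 1) < p\<close>. On vectors with entries in \<open>{0..<M}\<close>, a dominant equation modulo \<open>p\<close> holds
  over the integers, since both sides lie in \<open>{0..<p}\<close>; hence the dominant variable is a convex
  combination of the others. On a sphere, strict convexity forces all variables of the
  equation to coincide, and connectedness propagates this to all variables. By pigeonhole
  some sphere contains at least \<open>M ^ n / (n * (M - 1)\<^sup>2 + 1)\<close> such vectors.
\<close>

definition digit_sphere :: "int \<Rightarrow> nat \<Rightarrow> int \<Rightarrow> (nat \<Rightarrow> int) set" where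
  "digit_sphere M n R = {v \<in> {..<n} \<rightarrow>\<^sub>E {0..<M}. (\<Sum>k<n. (v k)\<^sup>2) = R}"

section \<open>Equations over the residue field as integer congruences\<close>

lemma residue_ring_finsum:
  assumes "1 < m" "finite A"
  shows "(\<Oplus>\<^bsub>residue_ring m\<^esub> i\<in>A. b i \<otimes>\<^bsub>residue_ring m\<^esub> x i) = (\<Sum>i\<in>A. b i * x i) mod m"
proof -
  interpret residues m "residue_ring m" using assms(1) by unfold_locales auto
  show ?thesis
    using assms(2)
  proof (induction A rule: finite_induct)
    case empty
    then show ?case by (simp add: res_zero_eq)
  next
    case (insert a A)
    have "b i \<otimes>\<^bsub>residue_ring m\<^esub> x i \<in> carrier (residue_ring m)" for i
      by (simp add: res_mult_eq mod_in_carrier)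
    with insert show ?case
      by (simp add: res_mult_eq res_add_eq mod_add_eq Pi_def)
  qed
qed

text \<open>Replacing coefficients by their residues does not change the sum modulo
  \<open>p\<close>. This gives access to the original integer coefficients, whose signs carry the
  dominance.\<close>

lemma Fp_solution_iff_dvd:
  assumes "1 < p"
  shows "Fp_solution p n (reduce_system p S) x \<longleftrightarrow>
    (\<forall>b\<in>S. \<forall>k<n. int p dvd (\<Sum>i\<in>UNIV. b i * x i k))"
proof -
  have "(\<Sum>i\<in>UNIV. b i mod int p * x i k) mod int p = (\<Sum>i\<in>UNIV. b i * x i k) mod int p"
    for b :: "'a \<Rightarrow> int" and k
    by (metis (mono_tags, lifting) mod_mult_left_eq mod_sum_eq sum.cong)
  moreover have "\<zero>\<^bsub>residue_ring (int p)\<^esub> = 0"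
    by (simp add: residue_ring_def)
  ultimately show ?thesis
    using assms
    by (simp add: Fp_solution_def reduce_system_def residue_ring_finsum dvd_eq_mod_eq_0)
qed

section \<open>A single dominant equation on digit vectors and on spheres\<close>

lemma dominant_at_coeff_nonzero: "dominant_at b j \<Longrightarrow> b j \<noteq> 0"
  by (auto simp: dominant_at_def)

lemma dominant_digits_abs_less:
  assumes "balanced_eq b" "dominant_at b j" "\<bar>b j\<bar> * (M - 1) < p"
    and "\<And>i. 0 \<le> y i" "\<And>i. y i < M"
  shows "\<bar>\<Sum>i\<in>UNIV. b i * y i\<bar> < p"
proof -
  \<comment> \<open>By balance, the weights \<open>- c i\<close> off \<open>j\<close> sum to
    \<open>c j\<close>. So \<open>c j * y j\<close> and the combined opposite contribution both lie
    between 0 and \<open>c j * (M - 1)\<close>, and their difference is below \<open>p\<close> in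
    absolute value. A negative dominant coefficient is handled by negating the equation.\<close>
  have pos: "\<bar>\<Sum>i\<in>UNIV. c i * y i\<bar> < p"
    if c: "balanced_eq c" "c j > 0" "\<And>i. i \<noteq> j \<Longrightarrow> c i \<le> 0" "c j * (M - 1) < p" for c
  proof -
    let ?N = "\<Sum>i\<in>UNIV - {j}. (- c i) * y i"
    have split: "(\<Sum>i\<in>UNIV. f i) = f j + (\<Sum>i\<in>UNIV - {j}. f i)" for f :: "'a \<Rightarrow> int"
      by (rule sum.remove) auto
    have eq: "(\<Sum>i\<in>UNIV. c i * y i) = c j * y j - ?N"
      by (subst split) (simp add: sum_negf)
    have cj: "(\<Sum>i\<in>UNIV - {j}. - c i) = c j"
      using c(1) split[of c] by (simp add: balanced_eq_def sum_negf)
    have "0 \<le> ?N"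
      using c(3) assms(4) by (intro sum_nonneg mult_nonneg_nonneg) auto
    moreover have "?N \<le> (\<Sum>i\<in>UNIV - {j}. (- c i) * (M - 1))"
      using c(3) assms(5) by (intro sum_mono mult_left_mono) (auto simp: zle_diff1_eq)
    then have "?N \<le> c j * (M - 1)"
      by (simp only: cj flip: sum_distrib_right)
    moreover have "0 \<le> c j * y j"
      using c(2) assms(4)[of j] by simp
    moreover have "c j * y j \<le> c j * (M - 1)"
      using c(2) assms(5)[of j] by (intro mult_left_mono) auto
    ultimately show ?thesis
      using c(4) eq by linarith
  qed
  show ?thesis
  proof (cases "b j > 0")
    case True
    then show ?thesis
      using pos[of b] assms(1-3) by (auto simp: dominant_at_def)
  next
    case False
    then have "\<bar>\<Sum>i\<in>UNIV. - b i * y i\<bar> < p"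
      using pos[of "\<lambda>i. - b i"] assms(1-3)
      by (auto simp: dominant_at_def balanced_eq_def sum_negf)
    then show ?thesis
      by (simp add: sum_negf)
  qed
qed

text \<open>Strict convexity in the form of a weighted sum of squared distances \<open>D i\<close>
  from \<open>x i\<close> to \<open>x j\<close>: this sum vanishes, while its terms all have the
  same sign.\<close>

lemma dominant_sphere_eq:
  fixes x :: "'r::finite \<Rightarrow> nat \<Rightarrow> int"
  assumes bal: "balanced_eq b" and dom: "dominant_at b j"
    and sol: "\<And>k. k < n \<Longrightarrow> (\<Sum>i\<in>UNIV. b i * x i k) = 0"
    and norm: "\<And>i. (\<Sum>k<n. (x i k)\<^sup>2) = R"
    and "b i \<noteq> 0" "k < n"
  shows "x i k = x j k"
proof -
  define D where "D i = (\<Sum>k<n. (x i k - x j k)\<^sup>2)" for i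
  have D0: "0 \<le> D i" for i
    unfolding D_def by (intro sum_nonneg) auto
  have "(\<Sum>i\<in>UNIV. b i * D i) = (\<Sum>k<n. \<Sum>i\<in>UNIV. b i * (x i k - x j k)\<^sup>2)"
    unfolding D_def sum_distrib_left by (rule sum.swap)
  also have "\<dots> = (\<Sum>k<n. \<Sum>i\<in>UNIV. b i * (x i k)\<^sup>2)"
  proof (rule sum.cong[OF refl])
    fix k assume "k \<in> {..<n}"
    \<comment> \<open>After expanding the square, the cross term vanishes by the equation and the
      constant term by balance. The remaining squares sum over \<open>k\<close> to \<open>R\<close>
      times the coefficient sum, which is again 0.\<close>
    have "(\<Sum>i\<in>UNIV. b i * (x i k - x j k)\<^sup>2)
        = (\<Sum>i\<in>UNIV. b i * (x i k)\<^sup>2 - (2 * x j k) * (b i * x i k) + (x j k)\<^sup>2 * b i)"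
      by (intro sum.cong) (auto simp: power2_eq_square algebra_simps)
    also have "\<dots> = (\<Sum>i\<in>UNIV. b i * (x i k)\<^sup>2) - (2 * x j k) * (\<Sum>i\<in>UNIV. b i * x i k)
        + (x j k)\<^sup>2 * (\<Sum>i\<in>UNIV. b i)"
      by (simp only: sum.distrib sum_subtractf sum_distrib_left)
    finally show "(\<Sum>i\<in>UNIV. b i * (x i k - x j k)\<^sup>2) = (\<Sum>i\<in>UNIV. b i * (x i k)\<^sup>2)"
      using sol[of k] bal \<open>k \<in> {..<n}\<close> by (simp add: balanced_eq_def)
  qed
  also have "\<dots> = (\<Sum>i\<in>UNIV. b i * (\<Sum>k<n. (x i k)\<^sup>2))"
    unfolding sum_distrib_left by (rule sum.swap)
  also have "\<dots> = 0"
    using bal by (simp add: norm balanced_eq_def flip: sum_distrib_right)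
  finally have sum0: "(\<Sum>i\<in>UNIV. b i * D i) = 0" .
  have "D j = 0" by (simp add: D_def)
  \<comment> \<open>Off \<open>j\<close> the coefficients share one sign, and at \<open>j\<close>
    the distance is 0, so no cancellation between terms is possible.\<close>
  have "b i * D i = 0"
  proof (cases "b j > 0")
    case True
    then have "b i * D i \<le> 0" for i
      using dom D0[of i] \<open>D j = 0\<close>
      by (cases "i = j") (auto simp: dominant_at_def mult_nonpos_nonneg)
    then show ?thesis
      using sum_nonneg_eq_0_iff[of UNIV "\<lambda>i. - (b i * D i)"] sum0 by (simp add: sum_negf)
  next
    case False
    then have "b i * D i \<ge> 0" for i
      using dom D0[of i] \<open>D j = 0\<close>
      by (cases "i = j") (auto simp: dominant_at_def)
    then show ?thesis
      using sum_nonneg_eq_0_iff[of UNIV "\<lambda>i. b i * D i"] sum0 by simp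
  qed
  with \<open>b i \<noteq> 0\<close> have "D i = 0" by simp
  then show ?thesis
    using \<open>k < n\<close> by (simp add: D_def sum_nonneg_eq_0_iff)
qed

section \<open>Strong freeness of digit spheres\<close>

lemma hypergraph_connected_const:
  assumes "hypergraph_connected V E" "u \<in> V" "v \<in> V"
    and edge: "\<And>e x y. e \<in> E \<Longrightarrow> x \<in> e \<Longrightarrow> y \<in> e \<Longrightarrow> f x = f y"
  shows "f u = f v"
proof -
  have "(u, v) \<in> {(x, y). \<exists>e\<in>E. x \<in> e \<and> y \<in> e}\<^sup>*"
    using assms(1-3) by (auto simp: hypergraph_connected_def)
  then show ?thesis
  proof (induction rule: rtrancl_induct)
    case (step y z)
    then obtain e where "e \<in> E" "y \<in> e" "z \<in> e" by blast
    with step.IH edge show ?case by metis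
  qed simp
qed

lemma dominant_eq_le_dominant_coeff:
  assumes "finite S" "b \<in> S" "balanced_eq b" "dominant_at b j"
  shows "\<bar>b j\<bar> \<le> dominant_coeff S"
  using assms by (auto simp: dominant_coeff_def simp flip: dominant_coeff_eq_abs)

lemma dominant_coeff_pos:
  assumes "finite S" "S \<noteq> {}" "dominant S"
  shows "0 < dominant_coeff S"
proof -
  obtain b where "b \<in> S" "dominant_eq b"
    using assms by (auto simp: dominant_def)
  moreover then obtain j where "balanced_eq b" "dominant_at b j"
    by (auto simp: dominant_eq_def)
  ultimately show ?thesis
    using dominant_eq_le_dominant_coeff[OF assms(1)] dominant_at_coeff_nonzero[of b j]
    by fastforce
qed

lemma strongly_free_digit_sphere:
  fixes S S' :: "('r::finite, int) eqsystem"
  assumes "finite S" "subsystem S' S" "dominant S'" "irreducible_system S'"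
    and "1 < p" "M \<le> int p" "dominant_coeff S' * (M - 1) < int p" "1 \<le> M"
  shows "strongly_free p n (reduce_system p S) (digit_sphere M n R)"
proof -
  have sub: "S' \<subseteq> S" and fin: "finite S'"
    using assms(1,2) by (auto simp: subsystem_def intro: finite_subset)
  have "{..<n} \<rightarrow>\<^sub>E {0..<M} \<subseteq> Fp_space p n"
    using assms(6) unfolding Fp_space_def by (intro PiE_mono) (auto simp: residue_ring_def)
  then have "digit_sphere M n R \<subseteq> Fp_space p n"
    by (auto simp: digit_sphere_def)
  moreover have "x u = x v"
    if A: "\<forall>i. x i \<in> digit_sphere M n R" and sol: "Fp_solution p n (reduce_system p S) x"
    for x :: "'r \<Rightarrow> nat \<Rightarrow> int" and u v
  proof (rule hypergraph_connected_const)
    show "hypergraph_connected UNIV (eq_support ` S')"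
      using assms(4) by (simp add: irreducible_system_def)
    \<comment> \<open>With \<open>f\<close> taken to be the solution \<open>x\<close> itself,
      connectedness leaves only two variables occurring in one equation of \<open>S'\<close>; a
      solution of \<open>S\<close> satisfies that equation since \<open>S'\<close> is contained in
      \<open>S\<close>.\<close>
    fix e i i' assume e: "e \<in> eq_support ` S'" "i \<in> e" "i' \<in> e"
    then obtain b where b: "b \<in> S'" "b i \<noteq> 0" "b i' \<noteq> 0"
      by (auto simp: eq_support_def)
    then obtain j where j: "balanced_eq b" "dominant_at b j"
      using assms(3) by (auto simp: dominant_def dominant_eq_def)
    have digit: "0 \<le> x i k" "x i k < M" if "k < n" for i k
      using A that by (auto simp: digit_sphere_def PiE_iff)
    have "\<bar>b j\<bar> * (M - 1) < int p"
      using dominant_eq_le_dominant_coeff[OF fin b(1) j] assms(7,8)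
      by (meson diff_ge_0_iff_ge le_less_trans mult_right_mono)
    then have "\<bar>\<Sum>i\<in>UNIV. b i * x i k\<bar> < int p" if "k < n" for k
      using digit[OF that] by (rule dominant_digits_abs_less[OF j])
    moreover have "int p dvd (\<Sum>i\<in>UNIV. b i * x i k)" if "k < n" for k
      using sol sub b(1) that Fp_solution_iff_dvd[OF assms(5)] by blast
    ultimately have "(\<Sum>i\<in>UNIV. b i * x i k) = 0" if "k < n" for k
      using that dvd_imp_le_int[of "\<Sum>i\<in>UNIV. b i * x i k" "int p"] by (metis abs_of_nat linorder_not_less)
    then have "x i k = x j k" "x i' k = x j k" if "k < n" for k
      using A b that
      by (intro dominant_sphere_eq[OF j, where R = R]; simp add: digit_sphere_def)+
    \<comment> \<open>Outside the coordinates below \<open>n\<close> both vectors take the same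
      default value, so agreement on the coordinates gives equality of functions.\<close>
    moreover have "x i \<in> extensional {..<n}" "x i' \<in> extensional {..<n}"
      using A by (auto simp: digit_sphere_def PiE_iff)
    ultimately show "x i = x i'"
      by (intro extensionalityI[of _ "{..<n}"]) auto
  qed auto
  ultimately show ?thesis
    by (auto simp: strongly_free_def)
qed

lemma card_le_ex_system:
  assumes "strongly_free p n (reduce_system p S) A"
  shows "card A \<le> ex_system S n p"
proof -
  \<comment> \<open>Finiteness of the ambient space bounds the set of cardinalities, so that the
    \<open>Max\<close> in \<open>ex_system\<close> really is a maximum.\<close>
  have "finite (Fp_space p n)"
    by (auto simp: Fp_space_def residue_ring_def intro!: finite_PiE)
  then have "finite {card A |A. strongly_free p n (reduce_system p S) A}"
    by (rule finite_subset[OF _ finite_imageI[OF finite_Pow_iff[THEN iffD2]], rotated])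
      (auto simp: strongly_free_def)
  with assms show ?thesis
    unfolding ex_system_def by (intro Max_ge) auto
qed

section \<open>Counting points on spheres and asymptotics\<close>

lemma large_digit_sphere:
  assumes "1 \<le> M"
  obtains R where "nat M ^ n \<le> card (digit_sphere M n R) * (n * nat ((M - 1)\<^sup>2) + 1)"
proof -
  let ?V = "{..<n} \<rightarrow>\<^sub>E {0..<M}" and ?f = "\<lambda>v. \<Sum>k<n. (v k)\<^sup>2"
  let ?B = "{0..int n * (M - 1)\<^sup>2}"
  \<comment> \<open>The squared norm takes at most \<open>n * (M - 1)\<^sup>2 + 1\<close> integer
    values; these are the pigeonholes.\<close>
  have "?f v \<in> ?B" if "v \<in> ?V" for v
  proof -
    have "(v k)\<^sup>2 \<le> (M - 1)\<^sup>2" if "k < n" for k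
      using \<open>v \<in> ?V\<close> that by (intro power_mono) (auto simp: PiE_iff)
    then have "?f v \<le> int n * (M - 1)\<^sup>2"
      using sum_bounded_above[of "{..<n}" "\<lambda>k. (v k)\<^sup>2" "(M - 1)\<^sup>2"] by simp
    then show ?thesis by (simp add: sum_nonneg)
  qed
  then obtain R where "card ?V \<le> card (?f -` {R} \<inter> ?V) * card ?B"
    using pigeonhole_card[of ?f ?V ?B] by (auto intro!: finite_PiE)
  moreover have "?f -` {R} \<inter> ?V = digit_sphere M n R"
    by (auto simp: digit_sphere_def)
  moreover have "card ?V = nat M ^ n"
    by (simp add: card_PiE)
  moreover have "card ?B = n * nat ((M - 1)\<^sup>2) + 1"
    by (simp add: nat_add_distrib nat_mult_distrib)
  ultimately show ?thesis
    using that by metis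
qed

lemma eventually_linear_times_power_le_1:
  fixes q C :: real
  assumes "0 \<le> q" "q < 1"
  shows "\<forall>\<^sub>F n in sequentially. q ^ n * (real n * C + 1) \<le> 1"
proof -
  have "(\<lambda>n. C * (real n * q ^ n) + q ^ n) \<longlonglongrightarrow> C * 0 + 0"
    using assms by (intro tendsto_intros powser_times_n_limit_0 LIMSEQ_power_zero) auto
  then have "\<forall>\<^sub>F n in sequentially. C * (real n * q ^ n) + q ^ n < 1"
    by (rule order_tendstoD) simp
  then show ?thesis
    by eventually_elim (simp add: algebra_simps)
qed

text \<open>The pigeonhole loss is linear in \<open>n\<close>, so the factor
  \<open>(1 - \<epsilon>) ^ n\<close> eventually absorbs it. The bound \<epsilon> \<le> 1 keeps this
  factor nonnegative; beyond it, even powers of a negative base could become large.\<close>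

lemma ex_system_lower_bound:
  fixes S S' :: "('r::finite, int) eqsystem"
  assumes "finite S" "subsystem S' S" "dominant S'" "irreducible_system S'"
    and "1 < p" "M \<le> int p" "dominant_coeff S' * (M - 1) < int p" "1 \<le> M"
    and "0 < \<epsilon>" "\<epsilon> \<le> (1::real)"
  shows "\<exists>n0. \<forall>n\<ge>n0. real (ex_system S n p) \<ge> ((1 - \<epsilon>) * of_int M) ^ n"
proof -
  define C where "C = nat ((M - 1)\<^sup>2)"
  obtain n0 where n0: "(1 - \<epsilon>) ^ n * (real n * real C + 1) \<le> 1" if "n \<ge> n0" for n
    using eventually_linear_times_power_le_1[of "1 - \<epsilon>" "real C"] assms(9,10)
    by (auto simp: eventually_sequentially)
  have "((1 - \<epsilon>) * of_int M) ^ n \<le> real (ex_system S n p)" if "n \<ge> n0" for n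
  proof -
    obtain R where R: "nat M ^ n \<le> card (digit_sphere M n R) * (n * C + 1)"
      using large_digit_sphere[OF assms(8)] unfolding C_def .
    let ?E = "real (ex_system S n p)" and ?d = "real n * real C + 1"
    have "card (digit_sphere M n R) \<le> ex_system S n p"
      using assms(1-8) by (intro card_le_ex_system strongly_free_digit_sphere[where S' = S'])
    with R have "nat M ^ n \<le> ex_system S n p * (n * C + 1)"
      by (meson le_trans mult_le_mono1)
    then have "real (nat M ^ n) \<le> real (ex_system S n p * (n * C + 1))"
      by (simp only: of_nat_le_iff)
    then have M: "of_int M ^ n \<le> ?E * ?d"
      using assms(8) by (simp add: algebra_simps)
    have "((1 - \<epsilon>) * of_int M) ^ n \<le> (1 - \<epsilon>) ^ n * (?E * ?d)"
      unfolding power_mult_distrib using M assms(10) by (intro mult_left_mono) auto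
    also have "\<dots> = ?E * ((1 - \<epsilon>) ^ n * ?d)"
      by simp
    also have "\<dots> \<le> ?E * 1"
      using n0[OF that] by (intro mult_left_mono) auto
    finally show ?thesis by simp
  qed
  then show ?thesis by blast
qed

theorem theorem2p9:
  fixes S S' :: "('r::finite, int) eqsystem"
  assumes "finite S" and "balanced S"
    and "subsystem S' S" and "dominant S'" and "irreducible_system S'"
  shows
    "(\<forall>p::nat. prime p \<and> int p > dominant_coeff S' \<longrightarrow>
        (\<forall>\<epsilon>::real. 0 < \<epsilon> \<and> \<epsilon> \<le> 1 \<longrightarrow>
          (\<exists>n0::nat. \<forall>n\<ge>n0.
            real (ex_system S n p) \<ge>
              ((1 - \<epsilon>) * real_of_int \<lfloor>(real p + real_of_int (dominant_coeff S') - 1)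
                                      / real_of_int (dominant_coeff S')\<rfloor>) ^ n)))
     \<and> (dominant_coeff S' \<ge> 2 \<longrightarrow>
        (\<forall>p::nat. prime p \<and> int p > dominant_coeff S' \<longrightarrow>
          (\<exists>n0::nat. \<forall>n\<ge>n0.
            real (ex_system S n p) \<ge> (real p / real_of_int (dominant_coeff S')) ^ n)))"
proof -
  define b where "b = dominant_coeff S'"
  have b: "b \<ge> 1"
    using dominant_coeff_pos[of S'] assms finite_subset[of S' S]
    by (auto simp: b_def subsystem_def)
  define M where "M p = (int p + b - 1) div b" for p
  have floor: "\<lfloor>(real p + of_int b - 1) / of_int b\<rfloor> = M p" for p
    using floor_divide_of_int_eq[of "int p + b - 1" b, where ?'a = real] by (simp add: M_def)
  have lower: "\<exists>n0. \<forall>n\<ge>n0. real (ex_system S n p) \<ge> ((1 - \<epsilon>) * of_int (M p)) ^ n"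
    if "prime p" "0 < \<epsilon>" "\<epsilon> \<le> 1" for p and \<epsilon> :: real
  proof (rule ex_system_lower_bound)
    show "1 < p" using that(1) by (rule prime_gt_1_nat)
    \<comment> \<open>The remainder is nonnegative, so \<open>b * (M p - 1)\<close> is at most
      \<open>int p - 1\<close>, exactly the strict bound that excludes wraparound modulo
      \<open>p\<close>.\<close>
    have "b * M p \<le> int p + b - 1"
      using b mult_div_mod_eq[of b "int p + b - 1"] pos_mod_sign[of b "int p + b - 1"]
      unfolding M_def by linarith
    then show M_less: "dominant_coeff S' * (M p - 1) < int p"
      by (simp add: b_def algebra_simps)
    show "1 \<le> M p"
      using b \<open>1 < p\<close> by (simp add: M_def pos_imp_zdiv_pos_iff int_one_le_iff_zero_less)
    then have "M p - 1 \<le> b * (M p - 1)"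
      using b by (simp add: mult_le_cancel_right1)
    with M_less show "M p \<le> int p"
      by (simp add: b_def)
  qed (use assms that in auto)
  have "\<exists>n0. \<forall>n\<ge>n0. real (ex_system S n p) \<ge> (real p / of_int b) ^ n"
    if p: "prime p" "b < int p" and b2: "2 \<le> b" for p
  proof -
    \<comment> \<open>Since \<open>p\<close> is prime and \<open>b\<close> lies strictly between 1
      and \<open>p\<close>, the quotient \<open>p / b\<close> is not an integer. Hence
      \<open>M p\<close> strictly exceeds it, which leaves room for a positive \<epsilon>.\<close>
    have "\<not> b dvd int p"
    proof
      assume "b dvd int p"
      moreover have "prime (int p)" using p by simp
      moreover have "0 \<le> b" using b2 by simp
      ultimately have "b = 1 \<or> b = int p"
        unfolding prime_int_iff by blast
      then show False using p b2 by linarith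
    qed
    then have "b * M p \<noteq> int p"
      by (metis dvd_triv_left)
    \<comment> \<open>Here the remainder is at most \<open>b - 1\<close>, which cancels the
      \<open>b - 1\<close> added before dividing.\<close>
    moreover have "int p \<le> b * M p"
      using b mult_div_mod_eq[of b "int p + b - 1"] pos_mod_bound[of b "int p + b - 1"]
      unfolding M_def by linarith
    ultimately have "int p < b * M p" by simp
    then have "real p < of_int b * of_int (M p)"
      by (metis of_int_less_iff of_int_mult of_int_of_nat_eq)
    then have less: "real p / of_int b < of_int (M p)"
      using b by (simp add: divide_less_eq mult.commute)
    moreover have pos: "0 < real p / of_int b"
      using b p prime_gt_0_nat by simp
    ultimately have Mpos: "0 < real_of_int (M p)" by linarith
    \<comment> \<open>Chosen so that \<open>(1 - \<epsilon>) * M p\<close> is exactly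
      \<open>p / b\<close>.\<close>
    define \<epsilon> where "\<epsilon> = 1 - real p / of_int b / of_int (M p)"
    have "0 < \<epsilon>" "\<epsilon> \<le> 1"
      using less pos Mpos divide_less_eq_1_pos[OF Mpos] divide_pos_pos[OF pos Mpos]
      unfolding \<epsilon>_def by (auto simp del: divide_divide_eq_left)
    moreover have "(1 - \<epsilon>) * of_int (M p) = real p / of_int b"
      using Mpos by (simp add: \<epsilon>_def)
    ultimately show ?thesis
      using lower[of p \<epsilon>] p by simp
  qed
  with lower show ?thesis
    by (simp add: floor flip: b_def)
qed

end
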